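(* For every integer $n\geq 1$, the game graph $G(\textsc{nim},*n)$ of single-heap Nim with starting heap of size $n$ has order $n+1$, size $\binom{n+1}{2}$, and metric dimension $\lceil \frac{n}{2}\rceil$.
   Context: Single-heap Nim: a position $*k$ is a heap of $k\ge 0$ stones ($*0$ is written $0$); a move removes any positive number of stones from the heap, i.e. goes from $*k$ to $*j$ for any $0\le j<k$. The game graph $G(\textsc{nim},*n)$ is the digraph whose vertices are all positions reachable from $*n$ (including $*n$ itself), with an arc from a position $p$ to a position $q$ whenever there is a legal move from $p$ to $q$ (each position appears as one vertex). The order of a graph is its number of vertices; its size is its number of arcs. Signed distance: in a digraph, let $d(u,v)$ be the number of arcs in a shortest directed path from $u$ to $v$ ($\infty$ if there is none, $d(u,u)=0$). The signed distance is $$d_{\pm}(u,v)=\begin{cases} d(u,v) & \text{if there is a directed } uv\text{-path and } d(u,v)\le d(v,u),\\ -d(v,u) & \text{if there is a directed } vu\text{-path and } d(v,u)<d(u,v),\\ \infty & \text{if there is neither a directed } uv\text{-path nor a directed } vu\text{-path.}\end{cases}$$ Metric dimension: for an ordered set $S=(u_1,\dots,u_k)$ of vertices, the distance vector of a vertex $v$ is $(d_\pm(u_1,v),\dots,d_\pm(u_k,v))$. $S$ is a resolving set if distinct vertices of the graph have distinct distance vectors. The metric dimension is the minimum cardinality of a resolving set. *)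

theory Defs
  imports Complex_Main "HOL-Library.Extended_Nat" "HOL-Library.Extended_Real"
    "Graph_Theory.Graph_Theory"
begin

definition graph_order :: "('a, 'b) pre_digraph \<Rightarrow> nat" where
  "graph_order G = card (verts G)"

definition graph_size :: "('a, 'b) pre_digraph \<Rightarrow> nat" where
  "graph_size G = card (arcs G)"


(* The infimum over the empty set of paths is infinity. *)
definition digraph_dist :: "('a, 'b) pre_digraph \<Rightarrow> 'a \<Rightarrow> 'a \<Rightarrow> enat" where
  "digraph_dist G u v = (INF p \<in> {p. pre_digraph.apath G u p v}. enat (length p))"

(* If neither of the first two conditions holds, there is no directed path in either
   direction: by linearity of the order, a path in one direction has finite length and
   so makes one of the two comparisons succeed. *)
definition signed_dist :: "('a, 'b) pre_digraph \<Rightarrow> 'a \<Rightarrow> 'a \<Rightarrow> ereal" where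
  "signed_dist G u v =
    (if (\<exists>p. pre_digraph.apath G u p v) \<and> digraph_dist G u v \<le> digraph_dist G v u
     then ereal_of_enat (digraph_dist G u v)
     else if (\<exists>p. pre_digraph.apath G v p u) \<and> digraph_dist G v u < digraph_dist G u v
     then - ereal_of_enat (digraph_dist G v u)
     else \<infinity>)"

definition distance_vector :: "('a, 'b) pre_digraph \<Rightarrow> 'a list \<Rightarrow> 'a \<Rightarrow> ereal list" where
  "distance_vector G S v = map (\<lambda>u. signed_dist G u v) S"

(* Ordered sets of vertices are lists without repetitions. *)
definition resolving_set :: "('a, 'b) pre_digraph \<Rightarrow> 'a list \<Rightarrow> bool" where
  "resolving_set G S \<longleftrightarrow>
    distinct S \<and> set S \<subseteq> verts G \<and> inj_on (distance_vector G S) (verts G)"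

(* In a finite digraph any enumeration of all the vertices is resolving, because
   signed_dist G u v = 0 only for u = v; hence the minimum exists. *)
definition metric_dimension :: "('a, 'b) pre_digraph \<Rightarrow> nat" where
  "metric_dimension G = (LEAST k. \<exists>S. resolving_set G S \<and> length S = k)"


definition game_graph :: "('p \<Rightarrow> 'p \<Rightarrow> bool) \<Rightarrow> 'p \<Rightarrow> ('p, 'p \<times> 'p) pre_digraph" where
  "game_graph move s = with_proj
    \<lparr> pverts = {p. move\<^sup>*\<^sup>* s p},
      parcs = {(p, q). move\<^sup>*\<^sup>* s p \<and> move\<^sup>*\<^sup>* s q \<and> move p q} \<rparr>"

(* The position *k is represented by the number k of stones in the heap. *)
definition nim_move :: "nat \<Rightarrow> nat \<Rightarrow> bool" where
  "nim_move k j \<longleftrightarrow> (\<exists>m. 0 < m \<and> m \<le> k \<and> j = k - m)"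

end

(* The game graph is the transitive tournament on {0..n}, so u resolves a pair v < w exactly
   when v \<le> u \<le> w. Hence a resolving set is a vertex cover of the path 0, 1, ..., n: the odd
   numbers form one, and each of the disjoint edges {2i, 2i+1} must be hit. *)
theory Submission
  imports Defs
begin

lemma nim_move_iff: "nim_move k j \<longleftrightarrow> j < k"
  unfolding nim_move_def by (auto intro: exI[of _ "k - j"])

lemma nim_reachable_iff: "nim_move\<^sup>*\<^sup>* n p \<longleftrightarrow> p \<le> n"
proof
  show "p \<le> n" if "nim_move\<^sup>*\<^sup>* n p"
    using that by (induction rule: rtranclp_induct) (auto simp: nim_move_iff)
  show "nim_move\<^sup>*\<^sup>* n p" if "p \<le> n"
    using that by (cases "p = n") (auto simp: nim_move_iff intro: r_into_rtranclp)
qed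

abbreviation nim_graph :: "nat \<Rightarrow> (nat, nat \<times> nat) pre_digraph" where
  "nim_graph n \<equiv> game_graph nim_move n"

lemma verts_nim_graph [simp]: "verts (nim_graph n) = {..n}"
  by (auto simp: game_graph_def nim_reachable_iff)

text \<open>Written as a dependent sum over tails, so that the number of arcs is the Gauss sum of
  all p \<le> n.\<close>

lemma arcs_nim_graph: "arcs (nim_graph n) = (SIGMA p:{..n}. {..<p})"
  by (auto simp: game_graph_def nim_reachable_iff nim_move_iff)

lemma tail_head_nim_graph [simp]:
  "tail (nim_graph n) = fst" "head (nim_graph n) = snd"
  by (simp_all add: game_graph_def)

lemma graph_size_nim_graph: "graph_size (nim_graph n) = (n + 1) choose 2"
  by (simp add: graph_size_def arcs_nim_graph card_SigmaI atMost_atLeast0 gauss_sum_nat choose_two)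

interpretation nim: wf_digraph "nim_graph n" for n
  by unfold_locales (auto simp: arcs_nim_graph)

text \<open>Every arc leads to a strictly smaller heap, so walks only descend. This excludes paths
  from a smaller position to a larger one.\<close>

lemma awalk_nim_graph_le:
  "nim.awalk n u p v \<Longrightarrow> v \<le> u"
  by (induction p arbitrary: u) (force simp: nim.awalk_simps arcs_nim_graph)+

text \<open>A single move reaches any smaller heap and no move leads upwards, so 0, 1 and
  \<infinity> are the only distances.\<close>

lemma digraph_dist_nim_graph:
  assumes "u \<le> n" "v \<le> n"
  shows "digraph_dist (nim_graph n) u v = (if u = v then 0 else if v < u then 1 else \<infinity>)"
proof -
  consider "u = v" | "v < u" | "u < v" by linarith
  then show ?thesis
  proof cases
    case 1
    then have "nim.apath n u [] v"
      using assms by (simp add: nim.apath_Nil_iff)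
    then have "digraph_dist (nim_graph n) u v \<le> enat (length ([] :: (nat \<times> nat) list))"
      unfolding digraph_dist_def by (intro INF_lower) simp
    then show ?thesis using 1 by (simp add: zero_enat_def[symmetric])
  next
    case 2
    then have "nim.apath n u [(u, v)] v"
      using assms by (auto simp: nim.apath_Cons_iff nim.apath_Nil_iff arcs_nim_graph)
    then have "digraph_dist (nim_graph n) u v \<le> enat (length [(u, v)])"
      unfolding digraph_dist_def by (intro INF_lower) simp
    moreover have "1 \<le> digraph_dist (nim_graph n) u v"
      unfolding digraph_dist_def
    proof (rule INF_greatest, clarify)
      fix p assume "nim.apath n u p v"
      then have "p \<noteq> []" using 2 by (auto simp: nim.apath_Nil_iff)
      then show "1 \<le> enat (length p)" by (cases p) (auto simp: one_enat_def)
    qed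
    ultimately show ?thesis using 2 by (simp add: one_enat_def)
  next
    case 3
    \<comment> \<open>The infimum is now over the empty set, hence the top element of
      \<open>enat\<close>, which is \<infinity>.\<close>
    then have "{p. nim.apath n u p v} = {}"
      using awalk_nim_graph_le by (fastforce simp: nim.apath_def)
    then show ?thesis using 3 by (simp add: digraph_dist_def top_enat_def)
  qed
qed

text \<open>Provides the path-existence conditions in the case distinction of
  \<open>signed_dist\<close>.\<close>

lemma ex_apath_nim_graph:
  assumes "u \<le> n" "v \<le> u"
  shows "\<exists>p. nim.apath n u p v"
proof (cases "u = v")
  case True
  then have "nim.apath n u [] v" using assms by (simp add: nim.apath_Nil_iff)
  then show ?thesis ..
next
  case False
  then have "nim.apath n u [(u, v)] v"
    using assms by (auto simp: nim.apath_Cons_iff nim.apath_Nil_iff arcs_nim_graph)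
  then show ?thesis ..
qed

lemma signed_dist_nim_graph:
  assumes "u \<le> n" "v \<le> n"
  shows "signed_dist (nim_graph n) u v = (if u = v then 0 else if v < u then 1 else - 1)"
  using assms ex_apath_nim_graph[of u n v] ex_apath_nim_graph[of v n u]
  by (auto simp: signed_dist_def digraph_dist_nim_graph one_enat_def one_ereal_def)

text \<open>The signed distance from u records only whether the other vertex is equal, below or
  above. Two vertices look alike exactly when both lie strictly on the same side of u.\<close>

lemma signed_dist_nim_graph_eq_iff:
  assumes "u \<le> n" "v < w" "w \<le> n"
  shows "signed_dist (nim_graph n) u v = signed_dist (nim_graph n) u w \<longleftrightarrow> u < v \<or> w < u"
  using assms by (auto simp: signed_dist_nim_graph one_ereal_def)

lemma resolving_set_nim_graph_iff:
  "resolving_set (nim_graph n) S \<longleftrightarrow>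
    distinct S \<and> set S \<subseteq> {..n} \<and> (\<forall>v<n. v \<in> set S \<or> Suc v \<in> set S)"
proof (cases "set S \<subseteq> {..n}")
  case True
  have resolved_iff: "distance_vector (nim_graph n) S v \<noteq> distance_vector (nim_graph n) S w
      \<longleftrightarrow> (\<exists>u\<in>set S. v \<le> u \<and> u \<le> w)" if "v < w" "w \<le> n" for v w
    using True that signed_dist_nim_graph_eq_iff[of _ n v w]
    by (auto simp: distance_vector_def subset_iff not_less)
  have "inj_on (distance_vector (nim_graph n) S) {..n}
      \<longleftrightarrow> (\<forall>w\<le>n. \<forall>v<w. \<exists>u\<in>set S. v \<le> u \<and> u \<le> w)"
  proof
    assume inj: "inj_on (distance_vector (nim_graph n) S) {..n}"
    show "\<forall>w\<le>n. \<forall>v<w. \<exists>u\<in>set S. v \<le> u \<and> u \<le> w"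
    proof (intro allI impI)
      fix v w
      assume "w \<le> n" "v < w"
      then have "distance_vector (nim_graph n) S v \<noteq> distance_vector (nim_graph n) S w"
        using inj_onD[OF inj, of v w] by auto
      then show "\<exists>u\<in>set S. v \<le> u \<and> u \<le> w"
        using resolved_iff[OF \<open>v < w\<close> \<open>w \<le> n\<close>] by blast
    qed
  next
    assume "\<forall>w\<le>n. \<forall>v<w. \<exists>u\<in>set S. v \<le> u \<and> u \<le> w"
    then show "inj_on (distance_vector (nim_graph n) S) {..n}"
      using resolved_iff by (intro linorder_inj_onI') auto
  qed
  \<comment> \<open>Consecutive pairs suffice: for v < w the interval from v to w contains both v
    and \<open>Suc v\<close>. Conversely, the choice w = \<open>Suc v\<close> recovers the covering
    condition.\<close>
  also have "\<dots> \<longleftrightarrow> (\<forall>v<n. v \<in> set S \<or> Suc v \<in> set S)"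
  proof safe
    fix v
    assume cover: "\<forall>w\<le>n. \<forall>v<w. \<exists>u\<in>set S. v \<le> u \<and> u \<le> w" and "v < n" "Suc v \<notin> set S"
    then obtain u where "u \<in> set S" "v \<le> u" "u \<le> Suc v" by (meson Suc_leI lessI)
    then show "v \<in> set S" using \<open>Suc v \<notin> set S\<close> by (auto simp: le_Suc_eq)
  next
    fix v w
    assume "\<forall>v<n. v \<in> set S \<or> Suc v \<in> set S" "w \<le> n" "v < w"
    then have "v \<in> set S \<or> Suc v \<in> set S" "v \<le> w" "Suc v \<le> w" by auto
    then show "\<exists>u\<in>set S. v \<le> u \<and> u \<le> w" using le_Suc_eq by blast
  qed
  finally show ?thesis using True by (simp add: resolving_set_def)
qed (simp add: resolving_set_def)

text \<open>The value is the ceiling of n/2, expressed in natural-number division.\<close>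

lemma metric_dimension_nim_graph: "metric_dimension (nim_graph n) = (n + 1) div 2"
  unfolding metric_dimension_def
proof (rule Least_equality)
  \<comment> \<open>The odd numbers up to n, in increasing order.\<close>
  define S where "S = map (\<lambda>i. 2 * i + 1) [0..<(n + 1) div 2]"
  have "v \<in> set S \<or> Suc v \<in> set S" if "v < n" for v
  \<comment> \<open>Exactly one of v and \<open>Suc v\<close> is odd. Its index in the list is v
    \<open>div\<close> 2 in both cases, and v < n keeps this index in range.\<close>
  proof (cases "even v")
    case True
    then have "Suc v = 2 * (v div 2) + 1" "v div 2 < (n + 1) div 2" using that by auto
    then show ?thesis unfolding S_def by (auto simp: image_iff)
  next
    case False
    then have "v = 2 * (v div 2) + 1" "v div 2 < (n + 1) div 2" using that by auto
    then show ?thesis unfolding S_def by (auto simp: image_iff)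
  qed
  moreover have "distinct S" "set S \<subseteq> {..n}" "length S = (n + 1) div 2"
    by (auto simp: S_def distinct_map inj_on_def)
  ultimately show "\<exists>S. resolving_set (nim_graph n) S \<and> length S = (n + 1) div 2"
    unfolding resolving_set_nim_graph_iff by blast
next
  fix k
  assume "\<exists>S. resolving_set (nim_graph n) S \<and> length S = k"
  then obtain S where S: "distinct S" "\<forall>v<n. v \<in> set S \<or> Suc v \<in> set S" "length S = k"
    unfolding resolving_set_nim_graph_iff by blast
  \<comment> \<open>Halving sends both ends of the edge {2i, 2i+1} to i. As S meets each such edge,
    its image under halving contains every i in range, which bounds its cardinality from
    below.\<close>
  have "{..<(n + 1) div 2} \<subseteq> (\<lambda>u. u div 2) ` set S"
  proof
    fix i assume "i \<in> {..<(n + 1) div 2}"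
    \<comment> \<open>Thus 2i+1 \<le> n, so the whole edge lies in the graph and the covering
      condition applies to it.\<close>
    then have "2 * i < n" by auto
    with S(2) have "2 * i \<in> set S \<or> Suc (2 * i) \<in> set S" by blast
    moreover have "i = 2 * i div 2" "i = Suc (2 * i) div 2" by simp_all
    ultimately show "i \<in> (\<lambda>u. u div 2) ` set S" by blast
  qed
  then have "(n + 1) div 2 \<le> card (set S)"
    using surj_card_le[of "set S" "{..<(n + 1) div 2}"] by simp
  with S show "(n + 1) div 2 \<le> k" by (simp add: distinct_card)
qed

theorem theorem3p1:
  fixes n :: nat
  assumes "n \<ge> 1"
  shows "graph_order (game_graph nim_move n) = n + 1
    \<and> graph_size (game_graph nim_move n) = (n + 1) choose 2
    \<and> int (metric_dimension (game_graph nim_move n)) = \<lceil>real n / 2\<rceil>"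
proof -
  \<comment> \<open>The ceiling is the unique integer z with z - 1 < n/2 \<le> z; both bounds are
    checked by parity of n.\<close>
  have "int ((n + 1) div 2) = \<lceil>real n / 2\<rceil>"
    by (intro ceiling_unique[symmetric]) (cases "even n"; auto elim!: evenE oddE)+
  then show ?thesis
    by (simp add: graph_order_def graph_size_nim_graph metric_dimension_nim_graph)
qed

end
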